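(* For all integers $k\ge 0$ and $n\ge 1$, $$s_k(n) \ =\ a_k(n-2(k-1)),$$ where $a_k(m)$ is interpreted as $0$ whenever $m\le 0$.
   Context: Let $(F_n)_{n\ge 1}$ be the Fibonacci sequence with $F_1=F_2=1$ and $F_{n+2}=F_{n+1}+F_n$. Define $a_0(n)=F_n$ for $n\ge 1$, and for $k\ge 1$ define $a_k(n)=\sum_{i=1}^n a_{k-1}(i)$ for $n\ge 1$ (the $k$-fold iterated partial sums of the Fibonacci sequence); set $a_k(m)=0$ for $m\le 0$. For $n\ge 1$ and $k\ge 0$ define $$s_k(n) := \#\{S\subseteq \{1,2,\ldots,n\} : |S|\ge k \text{ and } \min S\ge |S|\},$$ where the empty set is regarded as satisfying $\min S\ge |S|$ (so it is counted when $k=0$). *)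

theory Defs
  imports Main "HOL-Number_Theory.Fib"
begin

text \<open>
  The index is an integer because the theorem evaluates the sequences at
  \<open>n - 2 * (k - 1)\<close>, which may be nonpositive; there the value is 0.
\<close>
fun iter_fib_sum :: "nat \<Rightarrow> int \<Rightarrow> nat" where
  "iter_fib_sum 0 m = (if m \<le> 0 then 0 else fib (nat m))"
| "iter_fib_sum (Suc k) m = (if m \<le> 0 then 0 else (\<Sum>i = 1..m. iter_fib_sum k i))"

text \<open>\<open>Min {}\<close> is unspecified, so the convention for the empty set is an explicit disjunct.\<close>
definition schreier :: "nat set \<Rightarrow> bool" where
  "schreier S \<longleftrightarrow> S = {} \<or> card S \<le> Min S"

definition schreier_count :: "nat \<Rightarrow> nat \<Rightarrow> nat" where
  "schreier_count k n = card {S. S \<subseteq> {1..n} \<and> k \<le> card S \<and> schreier S}"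

end

(* Removing the maximum n + 1 from a Schreier set and shifting the remaining elements down by one
   keeps min S - |S|, so it gives a Schreier set in {1..n-1} with one element less. Hence
   s_k(n+1) = s_k(n) + s_{k-1}(n-1), which is also the recurrence of the iterated partial sums. *)

theory Submission
  imports Defs
begin

text \<open>The quantifier is vacuous for the empty set, so the exceptional disjunct and
  \<open>Min\<close> both disappear.\<close>

lemma schreier_iff:
  assumes "finite S"
  shows "schreier S \<longleftrightarrow> (\<forall>x\<in>S. card S \<le> x)"
  using assms by (cases "S = {}") (auto simp: schreier_def Min_ge_iff)

definition schreier_sets :: "nat \<Rightarrow> nat \<Rightarrow> nat set set" where
  "schreier_sets k n = {S. S \<subseteq> {1..n} \<and> k \<le> card S \<and> schreier S}"

lemma schreier_count_eq: "schreier_count k n = card (schreier_sets k n)"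
  by (simp add: schreier_count_def schreier_sets_def)

lemma finite_schreier_sets: "finite (schreier_sets k n)"
  by (rule finite_subset[of _ "Pow {1..n}"]) (auto simp: schreier_sets_def)

definition shift_insert :: "nat \<Rightarrow> nat set \<Rightarrow> nat set" where
  "shift_insert n T = insert (Suc n) (Suc ` T)"

lemma card_shift_insert:
  assumes "T \<subseteq> {1..n - 1}"
  shows "card (shift_insert n T) = Suc (card T)"
proof -
  have "finite T"
    using assms by (auto intro: finite_subset)
  moreover have "n \<notin> T"
    using subsetD[OF assms, of n] by auto
  ultimately show ?thesis
    by (simp add: shift_insert_def card_insert_if card_image image_iff)
qed

text \<open>Cardinality and every old element grow by one, so the old constraints carry over. The
  new element \<open>Suc n\<close> imposes none, because \<open>card T\<close> is at most
  \<open>n\<close>.\<close>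

lemma schreier_shift_insert:
  assumes T: "T \<subseteq> {1..n - 1}"
  shows "schreier (shift_insert n T) \<longleftrightarrow> schreier T"
proof -
  have fin: "finite T"
    using T by (auto intro: finite_subset)
  have "card T \<le> n"
    using card_mono[OF _ T] by simp
  then show ?thesis
    using fin card_shift_insert[OF T]
    by (simp add: schreier_iff) (simp add: schreier_iff shift_insert_def)
qed

lemma inj_on_shift_insert: "inj_on (shift_insert n) (Pow {1..n - 1})"
proof (rule inj_on_inverseI)
  fix T assume "T \<in> Pow {1..n - 1}"
  then have "n \<notin> T"
    using subsetD[of T "{1..n - 1}" n] by auto
  \<comment> \<open>Since \<open>n\<close> is not in \<open>T\<close>, the element
    \<open>Suc n\<close> is only the inserted one; excluding \<open>n\<close> therefore gives a left
    inverse.\<close>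
  then show "{x. x \<noteq> n \<and> Suc x \<in> shift_insert n T} = T"
    by (auto simp: shift_insert_def)
qed

lemma shift_insert_surj:
  assumes S: "S \<subseteq> {1..Suc n}" "Suc n \<in> S" "schreier S"
  obtains T where "T \<subseteq> {1..n - 1}" "S = shift_insert n T"
proof
  have fin: "finite S"
    using S(1) by (auto intro: finite_subset)
  \<comment> \<open>A second element besides \<open>Suc n\<close> forces \<open>card S\<close> to be
    at least 2, hence every element to be at least 2. So shifting down never produces 0.\<close>
  have no_one: "x \<noteq> 1" if "x \<in> S" "x \<noteq> Suc n" for x
  proof -
    have "card {x, Suc n} \<le> card S"
      using that S(2) fin by (intro card_mono) auto
    also have "\<dots> \<le> x"
      using that(1) S(3) fin by (simp add: schreier_iff)
    finally show ?thesis
      using that(2) by auto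
  qed
  define T where "T = {x. x \<noteq> n \<and> Suc x \<in> S}"
  show "T \<subseteq> {1..n - 1}"
  proof
    fix x assume "x \<in> T"
    then have x: "x \<noteq> n" "Suc x \<in> S" by (auto simp: T_def)
    then have "Suc x \<le> Suc n" using S(1) by auto
    then show "x \<in> {1..n - 1}"
      using x no_one[of "Suc x"] by auto
  qed
  show "S = shift_insert n T"
  proof
    show "S \<subseteq> shift_insert n T"
    proof
      fix x assume x: "x \<in> S"
      then obtain y where "x = Suc y"
        using S(1) by (cases x) auto
      then show "x \<in> shift_insert n T"
        using x by (auto simp: shift_insert_def T_def)
    qed
  qed (use S(2) in \<open>auto simp: shift_insert_def T_def\<close>)
qed

text \<open>Sort the sets by whether they contain \<open>Suc n\<close>.\<close>

lemma schreier_sets_Suc: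
  "schreier_sets k (Suc n) =
    schreier_sets k n \<union> shift_insert n ` schreier_sets (k - 1) (n - 1)"
proof (intro equalityI subsetI)
  fix S assume S: "S \<in> schreier_sets k (Suc n)"
  show "S \<in> schreier_sets k n \<union> shift_insert n ` schreier_sets (k - 1) (n - 1)"
  proof (cases "Suc n \<in> S")
    case True
    with S obtain T where T: "T \<subseteq> {1..n - 1}" "S = shift_insert n T"
      using shift_insert_surj[of S n] by (auto simp: schreier_sets_def)
    then have "T \<in> schreier_sets (k - 1) (n - 1)"
      using S by (auto simp: schreier_sets_def card_shift_insert schreier_shift_insert)
    then show ?thesis
      using T by blast
  next
    case False
    then show ?thesis
      using S by (auto simp: schreier_sets_def atLeastAtMostSuc_conv)
  qed
next
  fix S assume "S \<in> schreier_sets k n \<union> shift_insert n ` schreier_sets (k - 1) (n - 1)"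
  then show "S \<in> schreier_sets k (Suc n)"
  proof
    assume "S \<in> schreier_sets k n"
    then show ?thesis by (auto simp: schreier_sets_def)
  next
    assume "S \<in> shift_insert n ` schreier_sets (k - 1) (n - 1)"
    then obtain T where T: "T \<subseteq> {1..n - 1}" "k - 1 \<le> card T" "schreier T"
      and S: "S = shift_insert n T"
      by (auto simp: schreier_sets_def)
    have "S \<subseteq> {1..Suc n}"
      using T(1) by (force simp: S shift_insert_def)
    then show ?thesis
      using T by (simp add: S schreier_sets_def card_shift_insert schreier_shift_insert)
  qed
qed

text \<open>The truncated subtractions are intended: for \<open>k = 0\<close> the size bound stays void, and for
  \<open>n = 0\<close> the set \<open>{1}\<close> comes from the empty set.\<close>

lemma schreier_count_Suc:
  "schreier_count k (Suc n) = schreier_count k n + schreier_count (k - 1) (n - 1)"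
proof -
  have "Suc n \<in> shift_insert n T" for T
    by (simp add: shift_insert_def)
  moreover have "Suc n \<notin> S" if "S \<in> schreier_sets k n" for S
    using that by (auto simp: schreier_sets_def)
  ultimately have "schreier_sets k n \<inter> shift_insert n ` schreier_sets (k - 1) (n - 1) = {}"
    by blast
  moreover have "inj_on (shift_insert n) (schreier_sets (k - 1) (n - 1))"
    by (rule inj_on_subset[OF inj_on_shift_insert]) (auto simp: schreier_sets_def)
  ultimately show ?thesis
    by (simp add: schreier_count_eq schreier_sets_Suc card_Un_disjoint finite_schreier_sets
        card_image)
qed

lemma schreier_count_0: "schreier_count k 0 = (if k = 0 then 1 else 0)"
proof -
  have "schreier_sets k 0 = (if k = 0 then {{}} else {})"
    by (auto simp: schreier_sets_def schreier_def)
  then show ?thesis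
    by (simp add: schreier_count_eq)
qed

lemma iter_fib_sum_nonpos: "m \<le> 0 \<Longrightarrow> iter_fib_sum k m = 0"
  by (cases k) auto

text \<open>For positive \<open>m\<close> the last summand is split off; otherwise all three terms
  vanish. Thus the recurrence can be applied without checking the sign of the index.\<close>

lemma iter_fib_sum_Suc_rec:
  "iter_fib_sum (Suc k) m = iter_fib_sum (Suc k) (m - 1) + iter_fib_sum k m"
proof (cases "m \<le> 0")
  case False
  then have "{1..m} = insert m {1..m - 1}"
    by auto
  then show ?thesis
    using False by simp
qed (simp add: iter_fib_sum_nonpos)

text \<open>Strong induction, as the recurrence reaches back two steps in \<open>n\<close>, with
  \<open>k\<close> arbitrary because it drops too. The induction starts at \<open>n = 0\<close>,
  where \<open>k = 0\<close> gives \<open>fib 2 = 1\<close> and any larger \<open>k\<close> a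
  nonpositive index.\<close>

lemma schreier_count_eq_iter_fib_sum:
  "schreier_count k n = iter_fib_sum k (int n - 2 * (int k - 1))"
proof (induction n arbitrary: k rule: less_induct)
  case (less n)
  show ?case
  proof (cases n)
    case 0
    then show ?thesis
      by (cases k) (auto simp: schreier_count_0 iter_fib_sum_nonpos numeral_2_eq_2)
  next
    case (Suc m)
    have rec: "schreier_count k n =
        iter_fib_sum k (int m - 2 * (int k - 1)) +
        iter_fib_sum (k - 1) (int (m - 1) - 2 * (int (k - 1) - 1))"
      using less.IH[of m k] less.IH[of "m - 1" "k - 1"] by (simp add: Suc schreier_count_Suc)
    show ?thesis
    proof (cases k)
      case 0
      \<comment> \<open>For \<open>m = 0\<close> the truncated \<open>m - 1\<close> yields
        \<open>fib 2\<close> in place of \<open>fib 1\<close>, which is harmless as both are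
        1.\<close>
      have "fib (Suc m + 2) = fib (m + 2) + fib (m - 1 + 2)"
        by (cases m) (auto simp: numeral_2_eq_2)
      moreover have "nat (int j + 2) = j + 2" for j
        by simp
      ultimately show ?thesis
        using rec 0 by (simp add: Suc del: of_nat_Suc fib.simps)
    next
      case (Suc j)
      \<comment> \<open>The indices differ only for \<open>m = 0\<close>, being
        \<open>2 - 2 * j\<close> and \<open>1 - 2 * j\<close>: with \<open>j = 0\<close> this is
        again \<open>fib 2 = fib 1\<close>, and with \<open>j\<close> positive both values are
        0.\<close>
      have "iter_fib_sum j (int (m - 1) - 2 * (int j - 1)) = iter_fib_sum j (int m + 1 - 2 * int j)"
      proof (cases m)
        case 0
        then show ?thesis
          by (cases j) (auto simp: iter_fib_sum_nonpos numeral_2_eq_2)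
      qed (simp add: algebra_simps)
      then show ?thesis
        using rec iter_fib_sum_Suc_rec[of j "int m + 1 - 2 * int j"]
        by (simp add: \<open>n = Suc m\<close> Suc algebra_simps del: iter_fib_sum.simps)
    qed
  qed
qed

theorem theorem1p2:
  fixes k n :: nat
  assumes "n \<ge> 1"
  shows "schreier_count k n = iter_fib_sum k (int n - 2 * (int k - 1))"
  by (rule schreier_count_eq_iter_fib_sum)

end
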